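(* For Risky Stochastic Knapsack the adaptivity gap $\sup_I \mathrm{ADAPT}(I)/\mathrm{ALG}(I)$ is at least $2$. This remains true when the supremum is restricted to instances in which every item has an $\varepsilon$-Noisy Bernoulli size distribution.
   Context: Stochastic Knapsack: an instance $I$ consists of $n$ items; item $i$ has a deterministic value $v_i\ge 0$ and a random nonnegative size $S_i$ drawn from a known distribution, independently across items. The knapsack capacity is $1$. A policy inserts items one at a time (each at most once) and may stop; execution ends when the policy stops or at the first overflow (total realized size of inserted items exceeds $1$). In Risky Stochastic Knapsack, an overflow yields total value $0$; otherwise the policy receives the sum of values of inserted items. $\mathrm{ADAPT}(I)$ is the maximum expected value over fully adaptive policies (which may choose each action based on all realized sizes so far) and $\mathrm{ALG}(I)$ the maximum over non-adaptive policies (fixed insertion sequence). For $\varepsilon>0$, a random variable $X$ has an $\varepsilon$-Noisy Bernoulli distribution if there is $p\in[0,1]$ with $X\in[1-\varepsilon,1]$ with probability $p$ and $X\le\varepsilon$ with probability $1-p$. *)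

theory Defs
  imports "HOL-Probability.Probability"
begin

record knapsack =
  num_items :: nat
  item_value :: "nat \<Rightarrow> real"
  item_size :: "nat \<Rightarrow> real measure"

definition knapsack_instance :: "knapsack \<Rightarrow> bool" where
  "knapsack_instance I \<longleftrightarrow>
     (\<forall>i<num_items I. 0 \<le> item_value I i \<and>
        prob_space (item_size I i) \<and> sets (item_size I i) = sets borel \<and>
        (AE x in item_size I i. 0 \<le> x))"

text \<open>The sizes are independent: their joint law is the product measure.\<close>

definition joint_sizes :: "knapsack \<Rightarrow> (nat \<Rightarrow> real) measure" where
  "joint_sizes I = PiM {..<num_items I} (item_size I)"

text \<open>
  A policy maps the realized sizes of the items inserted so far, in order of insertion, to the
  next item to insert, or to \<open>None\<close> to stop. The items themselves need not be part of the
  history, since a deterministic policy and the sizes determine them.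
\<close>

type_synonym policy = "real list \<Rightarrow> nat option"

text \<open>
  \<open>inserted \<pi> s k\<close> is the list of items inserted within the first \<open>k\<close> steps when the realized sizes
  are \<open>s\<close>. The list includes the item that causes an overflow, and does not change once the policy
  has stopped or the knapsack (of capacity 1) has overflowed.
\<close>

primrec inserted :: "policy \<Rightarrow> (nat \<Rightarrow> real) \<Rightarrow> nat \<Rightarrow> nat list" where
  "inserted \<pi> s 0 = []"
| "inserted \<pi> s (Suc k) =
     (let xs = inserted \<pi> s k in
      if sum_list (map s xs) > 1 then xs
      else (case \<pi> (map s xs) of None \<Rightarrow> xs | Some i \<Rightarrow> xs @ [i]))"

definition adaptive_policies :: "knapsack \<Rightarrow> policy set" where
  "adaptive_policies I =
     {\<pi>. (\<forall>k. (\<lambda>x. \<pi> (map x [0..<k])) \<in> PiM {..<k} (\<lambda>_. borel) \<rightarrow>\<^sub>M count_space UNIV) \<and>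
         (\<forall>s k. distinct (inserted \<pi> s k) \<and> set (inserted \<pi> s k) \<subseteq> {..<num_items I})}"

definition sequence_policy :: "nat list \<Rightarrow> policy" where
  "sequence_policy xs h = (if length h < length xs then Some (xs ! length h) else None)"

definition nonadaptive_policies :: "knapsack \<Rightarrow> policy set" where
  "nonadaptive_policies I =
     sequence_policy ` {xs. distinct xs \<and> set xs \<subseteq> {..<num_items I}}"

text \<open>
  As every item is inserted at most once, the execution is over after \<open>num_items I\<close> steps.
\<close>

definition risky_value :: "knapsack \<Rightarrow> policy \<Rightarrow> (nat \<Rightarrow> real) \<Rightarrow> real" where
  "risky_value I \<pi> s =
     (let xs = inserted \<pi> s (num_items I) in
      if sum_list (map s xs) > 1 then 0 else sum_list (map (item_value I) xs))"

definition expected_value :: "knapsack \<Rightarrow> policy \<Rightarrow> real" where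
  "expected_value I \<pi> = (LINT s|joint_sizes I. risky_value I \<pi> s)"

definition ADAPT :: "knapsack \<Rightarrow> real" where
  "ADAPT I = (SUP \<pi>\<in>adaptive_policies I. expected_value I \<pi>)"

definition ALG :: "knapsack \<Rightarrow> real" where
  "ALG I = (SUP \<pi>\<in>nonadaptive_policies I. expected_value I \<pi>)"

text \<open>
  The supremum is taken in the extended reals, so that it needs no boundedness. Instances with
  \<open>ALG I = 0\<close> are left out: there \<open>ADAPT I = 0\<close> as well and the ratio is undefined.
\<close>

definition adaptivity_gap :: "knapsack set \<Rightarrow> ereal" where
  "adaptivity_gap \<I> = (SUP I\<in>{I\<in>\<I>. ALG I > 0}. ereal (ADAPT I / ALG I))"

text \<open>
  The two cases of a noisy Bernoulli distribution are complementary events, of probabilities \<open>p\<close>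
  and \<open>1 - p\<close>. The event \<open>A\<close> matters only for \<open>\<epsilon> \<ge> 1/2\<close>, where the two ranges overlap; for
  \<open>\<epsilon> < 1/2\<close> see \<open>noisy_bernoulli_iff\<close>.
\<close>

definition noisy_bernoulli :: "real \<Rightarrow> real measure \<Rightarrow> bool" where
  "noisy_bernoulli \<epsilon> D \<longleftrightarrow>
     (\<exists>p\<in>{0..1}. \<exists>A\<in>sets borel. A \<subseteq> {1 - \<epsilon>..1} \<and>
        measure D A = p \<and> measure D ({..\<epsilon>} - A) = 1 - p)"

lemma noisy_bernoulli_iff:
  assumes "\<epsilon> < 1 / 2" and "prob_space D" and sets: "sets D = sets borel"
  shows "noisy_bernoulli \<epsilon> D \<longleftrightarrow>
    (\<exists>p\<in>{0..1}. measure D {1 - \<epsilon>..1} = p \<and> measure D {..\<epsilon>} = 1 - p)"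
proof -
  interpret prob_space D by fact
  have disj: "{1 - \<epsilon>..1} \<inter> {..\<epsilon>} = {}"
    using assms(1) by auto
  have le1: "measure D {1 - \<epsilon>..1} + measure D {..\<epsilon>} \<le> 1"
    using finite_measure_Union[OF _ _ disj] prob_le_1 by (metis sets atLeastAtMost_borel atMost_borel)
  show ?thesis
  proof
    assume "noisy_bernoulli \<epsilon> D"
    then obtain A where A: "A \<in> sets borel" "A \<subseteq> {1 - \<epsilon>..1}" "measure D ({..\<epsilon>} - A) = 1 - measure D A"
      unfolding noisy_bernoulli_def by blast
    have "{..\<epsilon>} - A = {..\<epsilon>}"
      using A(2) disj by blast
    moreover have "measure D A \<le> measure D {1 - \<epsilon>..1}"
      by (rule finite_measure_mono) (use A(2) sets in auto)
    ultimately show "\<exists>p\<in>{0..1}. measure D {1 - \<epsilon>..1} = p \<and> measure D {..\<epsilon>} = 1 - p"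
      using A(3) le1 by simp
  next
    assume "\<exists>p\<in>{0..1}. measure D {1 - \<epsilon>..1} = p \<and> measure D {..\<epsilon>} = 1 - p"
    moreover have "{..\<epsilon>} - {1 - \<epsilon>..1} = {..\<epsilon>}"
      using disj by blast
    ultimately show "noisy_bernoulli \<epsilon> D"
      unfolding noisy_bernoulli_def by (metis atLeastAtMost_borel order_refl)
  qed
qed

end

theory Submission imports Defs
begin

text \<open>
  Take six items of value 1, where item \<open>i\<close> has size \<open>e 2\<^sup>i\<close> with probability 2/3 and size
  \<open>1 - (e 2\<^sup>0 + \<dots> + e 2\<^sup>i\<^sup>-\<^sup>1)\<close> with probability 1/3. A large item exactly fills the knapsack after
  all its predecessors came out small, so inserting \<open>0, 1, 2, \<dots>\<close> up to the first large item never
  overflows, and its expected value is \<open>\<Sum>i<6. (2/3)\<^sup>i > 8/3\<close>. The small sizes are superincreasing,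
  so a large item together with any item of larger index overflows. Hence a fixed set of \<open>k\<close> items
  fits only if all but the last are small, and its value is at most \<open>k (2/3)\<^sup>k\<^sup>-\<^sup>1 \<le> 4/3\<close>.
\<close>

section \<open>The two-point size distributions and the instance built from them\<close>

definition small :: "real \<Rightarrow> nat \<Rightarrow> real" where
  "small e i = e * 2 ^ i"

text \<open>The subtracted term is the total of the small sizes below \<open>i\<close>, in the
  closed form of \<open>sum_small\<close>.\<close>

definition large :: "real \<Rightarrow> nat \<Rightarrow> real" where
  "large e i = 1 - e * (2 ^ i - 1)"

definition two_point :: "real \<Rightarrow> nat \<Rightarrow> real measure" where
  "two_point e i =
     distr (measure_pmf (bernoulli_pmf (1/3))) borel (\<lambda>b. if b then large e i else small e i)"

definition gap_instance :: "real \<Rightarrow> knapsack" where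
  "gap_instance e = \<lparr>num_items = 6, item_value = (\<lambda>_. 1), item_size = two_point e\<rparr>"

text \<open>Items are taken in order, so the history length is the next index and
  \<open>h ! j\<close> is the size of item \<open>j\<close>.\<close>

definition until_large :: "real \<Rightarrow> policy" where
  "until_large e h =
     (if length h < 6 \<and> (\<forall>j<length h. h ! j = small e j) then Some (length h) else None)"

lemma gap_instance_simps [simp]:
  "num_items (gap_instance e) = 6" "item_value (gap_instance e) = (\<lambda>_. 1)"
  "item_size (gap_instance e) = two_point e"
  by (simp_all add: gap_instance_def)

lemma prob_space_two_point: "prob_space (two_point e i)"
  unfolding two_point_def by (intro prob_space.prob_space_distr) (auto intro: measure_pmf.prob_space_axioms)

lemma sets_two_point [simp, measurable_cong]: "sets (two_point e i) = sets borel"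
  by (simp add: two_point_def)

lemma space_two_point [simp]: "space (two_point e i) = UNIV"
  by (simp add: two_point_def)

lemma measure_two_point:
  assumes "A \<in> sets borel"
  shows "measure (two_point e i) A =
    (if large e i \<in> A then 1/3 else 0) + (if small e i \<in> A then 2/3 else 0)"
proof -
  have "measure (two_point e i) A =
      measure (bernoulli_pmf (1/3)) {b. (if b then large e i else small e i) \<in> A}"
    unfolding two_point_def using assms by (subst measure_distr) (auto simp: vimage_def)
  also have "{b. (if b then large e i else small e i) \<in> A} =
      (if large e i \<in> A then {True} else {}) \<union> (if small e i \<in> A then {False} else {})"
    by auto
  also have "measure (bernoulli_pmf (1/3)) \<dots> =
      (if large e i \<in> A then 1/3 else 0) + (if small e i \<in> A then 2/3 else 0)"
    by (auto simp: measure_pmf_single measure_pmf.finite_measure_Union)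
  finally show ?thesis .
qed

lemma AE_two_point: "AE x in two_point e i. x = small e i \<or> x = large e i"
  unfolding two_point_def by (subst AE_distr_iff) auto

lemma sum_small: "(\<Sum>j<i. small e j) = e * (2 ^ i - 1)"
  by (induction i) (auto simp: small_def algebra_simps)

section \<open>Executions of fixed sequences\<close>

lemma inserted_sequence_policy:
  "sum_list (map s (inserted (sequence_policy xs) s k)) \<le> 1 \<Longrightarrow>
    inserted (sequence_policy xs) s k = take k xs"
  by (induction k)
    (auto simp: Let_def sequence_policy_def take_Suc_conv_app_nth split: if_splits)

text \<open>All or nothing: an overflow freezes the list with a total above 1, so a final list that
  fits has never overflowed and is all of \<open>xs\<close>.\<close>

lemma risky_value_sequence_policy:
  assumes "length xs \<le> num_items I"
  shows "risky_value I (sequence_policy xs) s = 0 \<or>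
    sum_list (map s xs) \<le> 1 \<and>
    risky_value I (sequence_policy xs) s = sum_list (map (item_value I) xs)"
  using inserted_sequence_policy[of s xs "num_items I"] assms
  by (auto simp: risky_value_def Let_def)

section \<open>The joint law of the sizes and the arithmetic of small and large sizes\<close>

interpretation sizes: product_prob_space "two_point e" "{..<6}" for e
  by (intro product_prob_spaceI prob_space_two_point)

lemma finite_product_prob_space_two_point: "finite_product_prob_space (two_point e) {..<6}"
  by unfold_locales simp

lemma joint_sizes_gap_instance: "joint_sizes (gap_instance e) = PiM {..<6} (two_point e)"
  by (simp add: joint_sizes_def)

lemma AE_sizes:
  "AE s in PiM {..<6} (two_point e). \<forall>i<6. s i = small e i \<or> s i = large e i"
proof -
  have "AE s in PiM {..<6} (two_point e). \<forall>i\<in>{..<6}. s i = small e i \<or> s i = large e i"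
    by (intro AE_finite_allI finite_lessThan sizes.AE_component AE_two_point)
  then show ?thesis by (simp only: Ball_def lessThan_iff)
qed

context
  fixes e :: real
  assumes e: "0 < e" "e * 64 \<le> 1/4"
begin

text \<open>Here 64 is \<open>2 ^ 6\<close>. The bound \<open>c\<close> is 1/4 for keeping small and
  large sizes apart, and \<open>\<epsilon>\<close> for the noisy Bernoulli condition.\<close>

lemma power_bound:
  assumes "i \<le> 6" "e * 64 \<le> c"
  shows "e * 2 ^ i \<le> c"
proof -
  have "(2::real) ^ i \<le> 2 ^ 6" using assms by (intro power_increasing) auto
  then have "e * 2 ^ i \<le> e * 64" using e by simp
  then show ?thesis using assms by linarith
qed

lemma small_pos: "0 < small e i"
  using e by (simp add: small_def)

lemma small_less_large: "i < 6 \<Longrightarrow> small e i < large e i"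
  using power_bound[OF _ e(2), of i] e by (simp add: small_def large_def algebra_simps)

text \<open>The large size of item \<open>j\<close> leaves room \<open>e * (2 ^ j - 1)\<close>,
  which is less than \<open>small e m\<close> for every later \<open>m\<close>.\<close>

lemma large_plus_small: "j < m \<Longrightarrow> large e j + small e m > 1"
  using e mult_strict_left_mono[OF power_strict_increasing[of j m "2::real"], of e]
  unfolding large_def small_def right_diff_distrib by linarith

text \<open>The event is a box in the product space, so independence makes its measure a product
  over the coordinates.\<close>

lemma prob_small:
  assumes "J \<subseteq> {..<6}"
  shows "{s \<in> space (PiM {..<6} (two_point e)). \<forall>j\<in>J. s j = small e j} \<in> sets (PiM {..<6} (two_point e))"
    and "measure (PiM {..<6} (two_point e)) {s \<in> space (PiM {..<6} (two_point e)). \<forall>j\<in>J. s j = small e j}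
      = (2/3) ^ card J"
proof -
  let ?X = "\<lambda>j. if j \<in> J then {small e j} else UNIV"
  have eq: "{s \<in> space (PiM {..<6} (two_point e)). \<forall>j\<in>J. s j = small e j} = PiE {..<6} ?X"
  proof (intro set_eqI)
    fix s
    have "(\<forall>j\<in>J. s j = small e j) \<longleftrightarrow> (\<forall>i\<in>{..<6}. s i \<in> ?X i)"
      using assms by (smt (verit) UNIV_I singleton_iff subset_iff)
    then show "s \<in> {s \<in> space (PiM {..<6} (two_point e)). \<forall>j\<in>J. s j = small e j} \<longleftrightarrow> s \<in> PiE {..<6} ?X"
      by (simp only: space_PiM space_two_point PiE_iff mem_Collect_eq UNIV_I) blast
  qed
  show "{s \<in> space (PiM {..<6} (two_point e)). \<forall>j\<in>J. s j = small e j} \<in> sets (PiM {..<6} (two_point e))"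
    unfolding eq by (intro sets_PiM_I_finite) auto
  have "measure (PiM {..<6} (two_point e)) (PiE {..<6} ?X) = (\<Prod>j<6. measure (two_point e j) (?X j))"
    by (intro finite_product_prob_space.prob_times[OF finite_product_prob_space_two_point]) auto
  \<comment> \<open>The small and the large size differ, so the singleton has mass exactly
    2/3.\<close>
  also have "\<dots> = (\<Prod>j<6. if j \<in> J then 2/3 else 1)"
    using small_less_large by (intro prod.cong refl) (force simp: measure_two_point)
  also have "\<dots> = (2/3) ^ card J"
    using assms by (simp add: prod.If_cases Int_absorb1)
  finally show "measure (PiM {..<6} (two_point e)) {s \<in> space (PiM {..<6} (two_point e)). \<forall>j\<in>J. s j = small e j}
      = (2/3) ^ card J"
    unfolding eq .
qed

section \<open>Upper bound for non-adaptive policies\<close>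

text \<open>A large item \<open>j\<close> below the maximal index overflows together with the item
  of maximal index, even if the latter is small. The order of insertion does not matter.\<close>

lemma small_of_fits:
  assumes xs: "distinct xs" "set xs \<subseteq> {..<6}" "sum_list (map s xs) \<le> 1"
    and s: "\<forall>i<6. s i = small e i \<or> s i = large e i"
    and j: "j \<in> set xs - {Max (set xs)}"
  shows "s j = small e j"
proof (rule ccontr)
  let ?m = "Max (set xs)"
  assume "s j \<noteq> small e j"
  moreover have "j < 6" using j xs by auto
  ultimately have large: "s j = large e j" using s by blast
  have m: "?m \<in> set xs" using j by (intro Max_in) auto
  have "j < ?m" using j by (metis DiffE List.finite_set Max_ge insertI1 le_neq_implies_less)
  have ge: "small e i \<le> s i" if "i \<in> set xs" for i
    using s xs(2) that small_less_large[of i] by fastforce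
  have "sum s {j, ?m} \<le> sum s (set xs)"
    using j m ge small_pos by (intro sum_mono2) (force intro: order.trans[OF less_imp_le])+
  then have "s j + s ?m \<le> 1"
    using xs j by (simp add: sum_list_distinct_conv_sum_set)
  then show False
    using large ge[OF m] large_plus_small[OF \<open>j < ?m\<close>] by simp
qed

lemma sequence_value_le:
  assumes xs: "distinct xs" "set xs \<subseteq> {..<6}"
  shows "expected_value (gap_instance e) (sequence_policy xs) \<le> 4/3"
proof -
  let ?M = "PiM {..<6} (two_point e)"
  define J where "J = set xs - {Max (set xs)}"
  define A where "A = {s \<in> space ?M. \<forall>j\<in>J. s j = small e j}"
  have J: "J \<subseteq> {..<6}" using xs by (auto simp: J_def)
  have A: "A \<in> sets ?M" "measure ?M A = (2/3) ^ card J"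
    using prob_small[OF J] by (auto simp: A_def)
  have len: "length xs \<le> 6"
    using xs by (metis card_lessThan card_mono distinct_card finite_lessThan)
  \<comment> \<open>For empty \<open>xs\<close> the set \<open>J\<close> is empty whatever
    \<open>Max {}\<close> is, and \<open>0 - 1 = 0\<close> on the naturals.\<close>
  have card: "card J = length xs - 1"
    using xs by (cases "xs = []") (auto simp: J_def distinct_card card_Diff_singleton)
  have "AE s in ?M. risky_value (gap_instance e) (sequence_policy xs) s \<le> real (length xs) * indicator A s"
    using AE_sizes[of e] AE_space
  proof eventually_elim
    case (elim s)
    then show ?case
      using risky_value_sequence_policy[of xs "gap_instance e" s] len small_of_fits[OF xs _ elim(1)]
      by (auto simp: A_def J_def sum_list_triv split: split_indicator)
  qed
  \<comment> \<open>Integrability is checked for the dominating function: a non-integrable left side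
    would have integral 0, and the bound is nonnegative.\<close>
  then have "expected_value (gap_instance e) (sequence_policy xs) \<le>
      (LINT s|?M. real (length xs) * indicator A s)"
    unfolding expected_value_def joint_sizes_gap_instance
    using A by (intro integral_mono_AE') (auto simp: less_top[symmetric] intro!: integrable_mult_right)
  also have "\<dots> = real (length xs) * (2/3) ^ (length xs - 1)"
    using A card sets.sets_into_space[OF A(1)] by (simp add: Int_absorb2)
  also have "\<dots> \<le> 4/3"
  proof -
    \<comment> \<open>The value 4/3 is attained at lengths 2 and 3; the other lengths give
      less.\<close>
    have "length xs = 0 \<or> length xs = 1 \<or> length xs = 2 \<or> length xs = 3 \<or>
        length xs = 4 \<or> length xs = 5 \<or> length xs = 6"
      using len by linarith
    then show ?thesis by (auto simp: power_divide)
  qed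
  finally show ?thesis .
qed

lemma nonadaptive_value_le:
  "\<pi> \<in> nonadaptive_policies (gap_instance e) \<Longrightarrow> expected_value (gap_instance e) \<pi> \<le> 4/3"
  unfolding nonadaptive_policies_def gap_instance_simps using sequence_value_le by blast

lemma ALG_le: "ALG (gap_instance e) \<le> 4/3"
  unfolding ALG_def
proof (rule cSUP_least)
  show "nonadaptive_policies (gap_instance e) \<noteq> {}"
    by (auto simp: nonadaptive_policies_def intro: exI[of _ "[]"])
qed (rule nonadaptive_value_le)

text \<open>Positivity admits the instance to the supremum in \<open>adaptivity_gap\<close>. Item 0
  alone suffices, since its large size is exactly 1.\<close>

lemma ALG_pos: "0 < ALG (gap_instance e)"
proof -
  have "expected_value (gap_instance e) (sequence_policy [0]) \<le> ALG (gap_instance e)"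
    unfolding ALG_def
  proof (rule cSUP_upper)
    show "sequence_policy [0] \<in> nonadaptive_policies (gap_instance e)"
      by (auto simp: nonadaptive_policies_def)
    show "bdd_above (expected_value (gap_instance e) ` nonadaptive_policies (gap_instance e))"
      by (rule bdd_aboveI2) (rule nonadaptive_value_le)
  qed
  moreover have "expected_value (gap_instance e) (sequence_policy [0]) = 1"
  proof -
    let ?M = "PiM {..<6} (two_point e)"
    have eq: "risky_value (gap_instance e) (sequence_policy [0]) = (\<lambda>s. if s 0 > 1 then 0 else 1)"
      by (auto simp: fun_eq_iff risky_value_def sequence_policy_def eval_nat_numeral)
    have "AE s in ?M. (if s 0 > 1 then 0 else 1 :: real) = 1"
      using AE_sizes[of e]
    proof eventually_elim
      case (elim s)
      then have "s 0 = small e 0 \<or> s 0 = large e 0" by simp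
      then show ?case using e by (auto simp: small_def large_def)
    qed
    then have "(LINT s|?M. (if s 0 > 1 then 0 else 1 :: real)) = (LINT s|?M. 1)"
      by (intro integral_cong_AE) measurable
    then show ?thesis
      by (simp add: expected_value_def joint_sizes_gap_instance eq sizes.P.prob_space)
  qed
  ultimately show ?thesis by simp
qed

section \<open>Expected value of the adaptive policy\<close>

text \<open>The filter form turns the total size and the value into sums of conditional terms. It
  keeps the first item that is not small, and nothing after it.\<close>

lemma inserted_until_large:
  "k \<le> 6 \<Longrightarrow> inserted (until_large e) s k = filter (\<lambda>i. \<forall>j<i. s j = small e j) [0..<k]"
proof (induction k)
  case (Suc k)
  let ?P = "\<lambda>i. \<forall>j<i. s j = small e j"
  have IH: "inserted (until_large e) s k = filter ?P [0..<k]" using Suc by simp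
  show ?case
  proof (cases "?P k")
    case True
    then have *: "filter ?P [0..<k] = [0..<k]" by (auto simp: filter_id_conv)
    have "sum_list (map s [0..<k]) = (\<Sum>j<k. small e j)"
      using True by (simp add: interv_sum_list_conv_sum_set_nat atLeast0LessThan)
    also have "\<dots> \<le> 1"
      using power_bound[OF _ e(2), of k] e Suc by (simp add: sum_small algebra_simps)
    finally have "sum_list (map s [0..<k]) \<le> 1" .
    moreover have "until_large e (map s [0..<k]) = Some k"
      using True Suc.prems by (simp add: until_large_def)
    ultimately show ?thesis
      using True by (simp add: IH *)
  next
    case False
    define j where "j = (LEAST j. s j \<noteq> small e j)"
    have j: "s j \<noteq> small e j" "?P j"
      using False LeastI_ex[of "\<lambda>j. s j \<noteq> small e j"] not_less_Least[of _ "\<lambda>j. s j \<noteq> small e j"]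
      unfolding j_def by blast+
    have "j < k" using False j by (metis linorder_less_linear less_trans)
    have "[0..<k] = [0..<Suc j] @ [Suc j..<k]"
      using \<open>j < k\<close> by (metis Suc_leI le0 upt_add_eq_append le_add_diff_inverse)
    moreover have "filter ?P [0..<Suc j] = [0..<Suc j]"
      using j by (auto simp: filter_id_conv less_Suc_eq)
    moreover have "filter ?P [Suc j..<k] = []"
      using j(1) by (auto simp: filter_empty_conv Suc_le_eq)
    ultimately have *: "filter ?P [0..<k] = [0..<Suc j]"
      by (simp only: filter_append append_Nil2)
    have "until_large e (map s [0..<Suc j]) = None"
      using j by (auto simp: until_large_def nth_append simp del: upt_Suc)
    \<comment> \<open>Item \<open>j\<close> may or may not overflow, but the list stays the same in
      both cases, because the policy returns \<open>None\<close>.\<close>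
    then have "inserted (until_large e) s (Suc k) = filter ?P [0..<k]"
      by (simp only: inserted.simps IH * Let_def option.case if_cancel)
    also have "\<dots> = filter ?P [0..<Suc k]"
      using False by simp
    finally show ?thesis .
  qed
qed simp

text \<open>Admissibility concerns every \<open>k\<close>, beyond the range of
  \<open>inserted_until_large\<close>; a separate induction shows that the list is always an initial
  segment of the six items.\<close>

lemma until_large_adaptive: "until_large e \<in> adaptive_policies (gap_instance e)"
proof -
  have "\<exists>m\<le>6. inserted (until_large e) s k = [0..<m]" for s k
  proof (induction k)
    case (Suc k)
    then obtain m where m: "m \<le> 6" "inserted (until_large e) s k = [0..<m]" by blast
    have "inserted (until_large e) s (Suc k) = [0..<m] \<or>
        m < 6 \<and> inserted (until_large e) s (Suc k) = [0..<Suc m]"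
      by (auto simp: m until_large_def Let_def)
    then show ?case using m by (metis Suc_leI)
  qed auto
  then have "distinct (inserted (until_large e) s k) \<and>
      set (inserted (until_large e) s k) \<subseteq> {..<6}" for s k
    by (metis distinct_upt atLeast0LessThan lessThan_subset_iff set_upt)
  moreover have "(\<lambda>x. until_large e (map x [0..<k])) \<in> PiM {..<k} (\<lambda>_. borel) \<rightarrow>\<^sub>M count_space UNIV"
    for k
  proof -
    have "(\<lambda>x. until_large e (map x [0..<k])) =
        (\<lambda>x. if k < 6 \<and> (\<forall>j\<in>{..<k}. x j = small e j) then Some k else None)"
      by (auto simp: until_large_def fun_eq_iff)
    then show ?thesis by simp
  qed
  ultimately show ?thesis
    by (simp add: adaptive_policies_def)
qed

text \<open>The induction tracks the exact total while all items are small: the first large item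
  then raises it to exactly 1, and all later terms are 0.\<close>

lemma until_large_fits:
  assumes "\<forall>i<6. s i = small e i \<or> s i = large e i" and "n \<le> 6"
  shows "(\<Sum>i<n. if \<forall>j<i. s j = small e j then s i else 0) \<le> 1"
proof -
  have "(if \<forall>j<n. s j = small e j
      then (\<Sum>i<n. if \<forall>j<i. s j = small e j then s i else 0) = e * (2 ^ n - 1)
      else (\<Sum>i<n. if \<forall>j<i. s j = small e j then s i else 0) \<le> 1)"
    using assms(2)
  proof (induction n)
    case (Suc n)
    have "s n = small e n \<or> s n = large e n" using assms(1) Suc.prems by simp
    then show ?case
      using Suc by (auto simp: less_Suc_eq small_def large_def algebra_simps split: if_splits)
  qed simp
  then show ?thesis
    using power_bound[OF assms(2) e(2)] e by (auto simp: algebra_simps split: if_splits)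
qed

text \<open>Overflow has probability 0, so the value is almost surely the number of inserted items.
  Item \<open>i\<close> is inserted with probability \<open>(2/3) ^ i\<close>, and expectations add
  up.\<close>

lemma expected_value_until_large:
  "expected_value (gap_instance e) (until_large e) = (\<Sum>i<6. (2/3) ^ i)"
proof -
  let ?M = "PiM {..<6} (two_point e)"
  let ?A = "\<lambda>i. {s \<in> space ?M. \<forall>j\<in>{..<i}. s j = small e j}"
  \<comment> \<open>\<open>t\<close> is the total size and \<open>c\<close> the number of the
    inserted items.\<close>
  define t where "t s = (\<Sum>i<6. if \<forall>j<i. s j = small e j then s i else 0)" for s
  define c where "c s = (\<Sum>i<6. if \<forall>j<i. s j = small e j then 1 else 0 :: real)" for s
  have A: "?A i \<in> sets ?M" "measure ?M (?A i) = (2/3) ^ i" if "i < 6" for i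
    using prob_small[of "{..<i}"] that by auto
  have val: "risky_value (gap_instance e) (until_large e) s = (if t s > 1 then 0 else c s)" for s
  proof -
    have "sum_list (map f (filter (\<lambda>i. \<forall>j<i. s j = small e j) [0..<6])) =
        (\<Sum>i<6. if \<forall>j<i. s j = small e j then f i else 0)" for f :: "nat \<Rightarrow> real"
      unfolding sum_list_map_filter' interv_sum_list_conv_sum_set_nat set_upt atLeast0LessThan ..
    then show ?thesis
      unfolding risky_value_def gap_instance_simps inserted_until_large[OF order_refl] Let_def t_def c_def
      by presburger
  qed
  have [measurable]: "(\<lambda>s. s i) \<in> borel_measurable ?M" if "i < 6" for i
    using measurable_component_singleton[of i "{..<6}" "two_point e"] that by simp
  have [measurable]: "Measurable.pred ?M (\<lambda>s. \<forall>j<i. s j = small e j)" if "i < 6" for i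
    using A(1)[OF that] unfolding pred_def by (simp only: Ball_def lessThan_iff)
  have [measurable]: "t \<in> borel_measurable ?M" "c \<in> borel_measurable ?M"
    unfolding t_def c_def by (auto intro!: borel_measurable_sum measurable_If)
  have "AE s in ?M. (if t s > 1 then 0 else c s) = c s"
    using AE_sizes[of e]
  proof eventually_elim
    case (elim s)
    then show ?case using until_large_fits[of s 6] by (simp add: t_def)
  qed
  then have "expected_value (gap_instance e) (until_large e) = (LINT s|?M. c s)"
    unfolding expected_value_def joint_sizes_gap_instance val
    by (intro integral_cong_AE) measurable
  also have "\<dots> = (LINT s|?M. (\<Sum>i<6. indicator (?A i) s))"
    unfolding c_def
    by (intro Bochner_Integration.integral_cong refl sum.cong) (auto simp: indicator_def)
  also have "\<dots> = (\<Sum>i<6. LINT s|?M. indicator (?A i) s)"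
    using A by (intro Bochner_Integration.integral_sum) (auto simp: less_top[symmetric])
  also have "\<dots> = (\<Sum>i<6. (2/3) ^ i)"
  proof (intro sum.cong refl)
    fix i :: nat assume "i \<in> {..<6}"
    then have "?A i \<inter> space ?M = ?A i" "measure ?M (?A i) = (2/3) ^ i"
      using A(2)[of i] by auto
    then show "(LINT s|?M. indicator (?A i) s) = (2/3 :: real) ^ i" by simp
  qed
  finally show ?thesis .
qed

text \<open>This crude bound supplies the boundedness that the real supremum in \<open>ADAPT\<close>
  requires.\<close>

lemma expected_value_le:
  assumes "\<pi> \<in> adaptive_policies (gap_instance e)"
  shows "expected_value (gap_instance e) \<pi> \<le> 6"
proof -
  let ?M = "PiM {..<6} (two_point e)"
  have "length (inserted \<pi> s 6) \<le> 6" for s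
  proof -
    have "distinct (inserted \<pi> s 6)" "set (inserted \<pi> s 6) \<subseteq> {..<6}"
      using assms by (auto simp: adaptive_policies_def)
    then show ?thesis by (metis card_lessThan card_mono distinct_card finite_lessThan)
  qed
  then have "risky_value (gap_instance e) \<pi> s \<le> 6" for s
    by (simp add: risky_value_def Let_def sum_list_triv)
  then have "expected_value (gap_instance e) \<pi> \<le> (LINT s|?M. 6)"
    unfolding expected_value_def joint_sizes_gap_instance
    by (intro integral_mono_AE') auto
  then show ?thesis by (simp add: sizes.P.prob_space)
qed

lemma ADAPT_ge: "8/3 \<le> ADAPT (gap_instance e)"
proof -
  \<comment> \<open>The sum is 665/243. Five items would give 211/81, which is below 8/3; hence the
    choice of six.\<close>
  have "(8/3 :: real) \<le> (\<Sum>i<6. (2/3) ^ i)"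
    by (simp add: eval_nat_numeral)
  also have "\<dots> = expected_value (gap_instance e) (until_large e)"
    by (simp add: expected_value_until_large)
  also have "\<dots> \<le> ADAPT (gap_instance e)"
    unfolding ADAPT_def
    by (intro cSUP_upper until_large_adaptive bdd_aboveI[of _ 6]) (auto simp: expected_value_le)
  finally show ?thesis .
qed

section \<open>Membership in the two classes of instances, and the gap\<close>

lemma knapsack_instance_gap_instance: "knapsack_instance (gap_instance e)"
proof -
  have "AE x in two_point e i. 0 \<le> x" if "i < 6" for i
    using AE_two_point[of e i]
    by eventually_elim (use small_pos[of i] small_less_large[OF that] in auto)
  then show ?thesis
    unfolding knapsack_instance_def gap_instance_simps by (simp add: prob_space_two_point)
qed

lemma noisy_bernoulli_two_point:
  assumes "i < 6" and "e * 64 \<le> \<epsilon>"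
  shows "noisy_bernoulli \<epsilon> (two_point e i)"
proof -
  have "small e i \<noteq> large e i" "small e i \<le> \<epsilon>"
    and "1 - \<epsilon> \<le> large e i" "large e i \<le> 1"
    using assms e small_less_large[of i] power_bound[OF _ assms(2), of i]
    by (auto simp: small_def large_def algebra_simps)
  \<comment> \<open>The singleton \<open>A\<close> also handles big \<open>\<epsilon>\<close>, where
    the large size may itself be at most \<open>\<epsilon>\<close> and has to be removed from the
    lower range.\<close>
  then show ?thesis
    unfolding noisy_bernoulli_def
    by (intro bexI[of _ "1/3"] bexI[of _ "{large e i}"]) (auto simp: measure_two_point)
qed

text \<open>The ratio is at least \<open>(8/3) / (4/3)\<close>. Leaving the class arbitrary serves
  both halves of the theorem.\<close>

lemma adaptivity_gap_ge_2:
  assumes "gap_instance e \<in> \<I>"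
  shows "2 \<le> adaptivity_gap \<I>"
  unfolding adaptivity_gap_def
proof (rule SUP_upper2)
  show "gap_instance e \<in> {I \<in> \<I>. 0 < ALG I}"
    using assms ALG_pos by simp
  have "2 \<le> ADAPT (gap_instance e) / ALG (gap_instance e)"
    using ALG_pos ALG_le ADAPT_ge by (simp add: field_simps)
  then show "2 \<le> ereal (ADAPT (gap_instance e) / ALG (gap_instance e))"
    by simp
qed

end

theorem mainTheorem7:
  shows "adaptivity_gap {I. knapsack_instance I} \<ge> 2 \<and>
    (\<forall>\<epsilon>>0. adaptivity_gap {I. knapsack_instance I \<and>
       (\<forall>i<num_items I. noisy_bernoulli \<epsilon> (item_size I i))} \<ge> 2)"
proof (intro conjI allI impI)
  show "adaptivity_gap {I. knapsack_instance I} \<ge> 2"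
    by (rule adaptivity_gap_ge_2[of "1/256"]) (auto intro: knapsack_instance_gap_instance)
next
  fix \<epsilon> :: real assume "\<epsilon> > 0"
  then show "adaptivity_gap {I. knapsack_instance I \<and>
      (\<forall>i<num_items I. noisy_bernoulli \<epsilon> (item_size I i))} \<ge> 2"
    \<comment> \<open>With this \<open>e\<close>, \<open>e * 64\<close> equals
      \<open>min \<epsilon> (1/4)\<close>, which meets the standing bound on \<open>e\<close> and
      the noisy Bernoulli bound at once.\<close>
    by (intro adaptivity_gap_ge_2[of "min \<epsilon> (1/4) / 64"])
      (auto intro: knapsack_instance_gap_instance noisy_bernoulli_two_point)
qed

end
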